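(* Let $\mu_1,\mu_2\in\mathbb{C}\setminus\{3+2\sqrt{2}\}$ be distinct. Let $m\ge1$, let $\mathbf{f}$ be a binary function of dimension $m$ with ground set $\{e_0,\ldots,e_{m-1}\}$, let $i\in\{0,\ldots,m-1\}$, and suppose the minors $\mathbf{f}\,\|_{[\mu_1]}e_i$ and $\mathbf{f}\,\|_{[\mu_2]}e_i$ are both defined. The following are equivalent. (a) The element $e_i$ is degenerate in $\mathbf{f}$ with respect to the two minor operations with parameters $\mu_1$ and $\mu_2$; that is, $\mathbf{f}\,\|_{[\mu_1]}e_i=\mathbf{f}\,\|_{[\mu_2]}e_i$. (b) For all $G\in\{0,1\}^{\{0,\ldots,m-2\}}$, \[ f_{G:i\leftarrow 1}\, f_{0:i\leftarrow 0} = f_{G:i\leftarrow 0}\, f_{0:i\leftarrow 1}. \] (c) For all $G\in\{0,1\}^{\{0,\ldots,m-2\}}$, either \[ \frac{f_{G:i\leftarrow 1}}{f_{G:i\leftarrow 0}} = \frac{f_{0:i\leftarrow 1}}{f_{0:i\leftarrow 0}} \] (with $f_{G:i\leftarrow 0}\ne 0$), or \[ f_{G:i\leftarrow 0}=f_{G:i\leftarrow 1}=0 . \]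
   Context: A binary function of dimension $m$ with ground set $E=\{e_0,\ldots,e_{m-1}\}$ is a function $f:2^E\to\mathbb{C}$ with $f(\emptyset)=1$. It is identified with the vector $\mathbf{f}\in\mathbb{C}^{2^m}$ whose entries $f_{\mathbf{x}}$ are indexed by bit sequences $\mathbf{x}=(x_0,\ldots,x_{m-1})\in\{0,1\}^m$ (characteristic vectors of subsets of $E$, with $x_j=1$ iff $e_j$ is in the subset), listed in the order of the numbers $\sum_j x_j 2^{m-1-j}$. For $\mu\in\mathbb{C}\setminus\{3+2\sqrt2\}$ put \[ \lambda(\mu)=\frac{1+\mu}{\sqrt{2}+1-(\sqrt{2}-1)\mu}. \] The $[\mu]$-minor of $\mathbf{f}$ by $e_i$ is the $2^{m-1}$-element vector, indexed by subsets of $E\setminus\{e_i\}$, \[ \mathbf{f}\,\|_{[\mu]}e_i := c\cdot\bigl(I_2^{\otimes i}\otimes (\,1\;\;\lambda(\mu)\,)\otimes I_2^{\otimes(m-i-1)}\bigr)\mathbf{f}, \] where $I_2$ is the $2\times 2$ identity matrix, $(\,1\;\;\lambda(\mu)\,)$ is a $1\times2$ row, and the scalar $c\in\mathbb{C}$ is such that the $\emptyset$-entry of the minor is $1$. The minor is defined when such $c$ exists, i.e. when $1+\lambda(\mu)f(\{e_i\})\neq 0$. Entrywise, the entry of $\mathbf{f}\,\|_{[\mu]}e_i$ indexed by $G\in\{0,1\}^{m-1}$ is $c\,(f_{G:i\leftarrow 0}+\lambda(\mu) f_{G:i\leftarrow 1})$. An element is degenerate with respect to a set of minor operations if all these operations,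 applied to that element, give the same result. For $G=(g_0,\ldots,g_{m-2})\in\{0,1\}^{\{0,\ldots,m-2\}}$ and $b\in\{0,1\}$, the sequence $G:i\leftarrow b$ is $(g_0,\ldots,g_{i-1},b,g_i,\ldots,g_{m-2})\in\{0,1\}^m$. The symbol $0$ in $0:i\leftarrow b$ denotes the all-zero sequence of length $m-1$; in particular $f_{0:i\leftarrow 0}=f(\emptyset)=1$. *)

theory Defs
  imports Complex_Main "Jordan_Normal_Form.Matrix"
begin

text \<open>
  The ground set \<open>E = {e\<^sub>0, \<dots>, e\<^sub>m\<^sub>-\<^sub>1}\<close> comes with an enumeration and is given as a distinct list \<open>es\<close>;
  the dimension is \<open>length es\<close>. Only the values of \<open>f\<close> on subsets of \<open>set es\<close> are ever used.
\<close>

definition binary_function :: "nat \<Rightarrow> 'a list \<Rightarrow> ('a set \<Rightarrow> complex) \<Rightarrow> bool" where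
  "binary_function m es f \<longleftrightarrow> distinct es \<and> length es = m \<and> f {} = 1"

definition subset_of_seq :: "'a list \<Rightarrow> bool list \<Rightarrow> 'a set" where
  "subset_of_seq es x = {es ! j | j. j < length es \<and> x ! j}"

definition bf_entry :: "'a list \<Rightarrow> ('a set \<Rightarrow> complex) \<Rightarrow> bool list \<Rightarrow> complex" where
  "bf_entry es f x = f (subset_of_seq es x)"

definition seq_index :: "bool list \<Rightarrow> nat" where
  "seq_index x = (\<Sum>j<length x. of_bool (x ! j) * 2 ^ (length x - 1 - j))"

text \<open>The sequence of length \<open>m\<close> with index \<open>k\<close>, most significant bit first; see
  \<open>seq_index_seq_of_index\<close> and \<open>seq_of_index_seq_index\<close> below.\<close>

definition seq_of_index :: "nat \<Rightarrow> nat \<Rightarrow> bool list" where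
  "seq_of_index m k = map (\<lambda>j. odd (k div 2 ^ (m - 1 - j))) [0..<m]"

definition bf_vec :: "'a list \<Rightarrow> ('a set \<Rightarrow> complex) \<Rightarrow> complex vec" where
  "bf_vec es f = vec (2 ^ length es) (\<lambda>k. bf_entry es f (seq_of_index (length es) k))"

definition kron :: "complex mat \<Rightarrow> complex mat \<Rightarrow> complex mat" where
  "kron A B = mat (dim_row A * dim_row B) (dim_col A * dim_col B)
     (\<lambda>(r, c). A $$ (r div dim_row B, c div dim_col B) * B $$ (r mod dim_row B, c mod dim_col B))"

fun kron_power :: "complex mat \<Rightarrow> nat \<Rightarrow> complex mat" where
  "kron_power A 0 = 1\<^sub>m 1"
| "kron_power A (Suc n) = kron A (kron_power A n)"

definition lam :: "complex \<Rightarrow> complex" where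
  "lam \<mu> = (1 + \<mu>) / (of_real (sqrt 2) + 1 - (of_real (sqrt 2) - 1) * \<mu>)"

definition minor_unscaled :: "nat \<Rightarrow> complex \<Rightarrow> complex vec \<Rightarrow> nat \<Rightarrow> complex vec" where
  "minor_unscaled m \<mu> v i =
     kron (kron (kron_power (1\<^sub>m 2) i) (mat_of_rows_list 2 [[1, lam \<mu>]])) (kron_power (1\<^sub>m 2) (m - i - 1)) *\<^sub>v v"

text \<open>Position \<open>0\<close> of a vector is its entry at the empty set.\<close>

definition minor_defined :: "nat \<Rightarrow> complex \<Rightarrow> complex vec \<Rightarrow> nat \<Rightarrow> bool" where
  "minor_defined m \<mu> v i \<longleftrightarrow> (\<exists>c. (c \<cdot>\<^sub>v minor_unscaled m \<mu> v i) $ 0 = 1)"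

definition mu_minor :: "nat \<Rightarrow> complex \<Rightarrow> complex vec \<Rightarrow> nat \<Rightarrow> complex vec" where
  "mu_minor m \<mu> v i =
     (THE c. (c \<cdot>\<^sub>v minor_unscaled m \<mu> v i) $ 0 = 1) \<cdot>\<^sub>v minor_unscaled m \<mu> v i"

definition degenerate :: "(complex vec \<Rightarrow> nat \<Rightarrow> complex vec) set \<Rightarrow> complex vec \<Rightarrow> nat \<Rightarrow> bool" where
  "degenerate ops v i \<longleftrightarrow> (\<forall>op1 \<in> ops. \<forall>op2 \<in> ops. op1 v i = op2 v i)"

definition insert_bit :: "bool list \<Rightarrow> nat \<Rightarrow> bool \<Rightarrow> bool list" where
  "insert_bit G i b = take i G @ b # drop i G"

definition zero_seq :: "nat \<Rightarrow> bool list" where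
  "zero_seq n = replicate n False"

lemma length_seq_of_index [simp]: "length (seq_of_index m k) = m"
  by (simp add: seq_of_index_def)

lemma seq_index_snoc: "seq_index (x @ [b]) = 2 * seq_index x + of_bool b"
proof -
  have "(\<Sum>j<length x. of_bool ((x @ [b]) ! j) * 2 ^ (length x - j))
      = (\<Sum>j<length x. 2 * (of_bool (x ! j) * 2 ^ (length x - 1 - j)) :: nat)"
  proof (rule sum.cong)
    fix j assume "j \<in> {..<length x}"
    then have "length x - j = Suc (length x - 1 - j)" "(x @ [b]) ! j = x ! j"
      by (auto simp: nth_append)
    then show "of_bool ((x @ [b]) ! j) * 2 ^ (length x - j)
        = (2 * (of_bool (x ! j) * 2 ^ (length x - 1 - j)) :: nat)"
      by simp
  qed simp
  then show ?thesis
    by (simp add: seq_index_def sum_distrib_left del: sum_of_bool_mult_eq sum_mult_of_bool_eq)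
qed

lemma seq_of_index_Suc: "seq_of_index (Suc m) k = seq_of_index m (k div 2) @ [odd k]"
proof -
  have "k div 2 ^ (m - j) = k div 2 div 2 ^ (m - 1 - j)" if "j < m" for j
  proof -
    have "m - j = Suc (m - 1 - j)" using that by simp
    then show ?thesis by (simp add: div_mult2_eq)
  qed
  then show ?thesis
    by (simp add: seq_of_index_def)
qed

lemma seq_index_seq_of_index: "k < 2 ^ m \<Longrightarrow> seq_index (seq_of_index m k) = k"
proof (induction m arbitrary: k)
  case 0
  then show ?case by (simp add: seq_index_def seq_of_index_def)
next
  case (Suc m)
  then have "seq_index (seq_of_index m (k div 2)) = k div 2" by auto
  then show ?case
    by (simp add: seq_of_index_Suc seq_index_snoc)
qed

lemma seq_of_index_seq_index: "seq_of_index (length x) (seq_index x) = x"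
proof (induction x rule: rev_induct)
  case Nil
  then show ?case by (simp add: seq_of_index_def)
next
  case (snoc b x)
  then show ?case by (simp add: seq_of_index_Suc seq_index_snoc)
qed

end

theory Submission
  imports Defs
begin

text \<open>
  Fix \<open>\<lambda>\<^sub>1 = lam \<mu>1\<close> and \<open>\<lambda>\<^sub>2 = lam \<mu>2\<close>, and write \<open>a, b\<close> for the entries of \<open>f\<close> at
  \<open>G:i\<leftarrow>0\<close> and \<open>G:i\<leftarrow>1\<close>, and \<open>b\<^sub>0\<close> for the entry at \<open>0:i\<leftarrow>1\<close>; the entry at \<open>0:i\<leftarrow>0\<close> is \<open>1\<close>.
  The entry of the \<open>[\<mu>]\<close>-minor at \<open>G\<close> is \<open>(a + \<lambda> b) / (1 + \<lambda> b\<^sub>0)\<close>. Clearing denominators,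
  the two minors agree at \<open>G\<close> iff \<open>(\<lambda>\<^sub>2 - \<lambda>\<^sub>1) (a b\<^sub>0 - b) = 0\<close>
  (lemma \<open>linear_fractional_eq_iff\<close>). The map \<open>lam\<close> is a nonsingular Moebius transformation, its
  determinant being \<open>2 \<surd>2\<close>, so \<open>\<lambda>\<^sub>1 \<noteq> \<lambda>\<^sub>2\<close> (lemma \<open>lam_eq_iff\<close>) and the condition is
  \<open>b = a b\<^sub>0\<close>. This is (b), and (c) is the same equation divided by \<open>a\<close>, the case \<open>a = 0\<close>
  being treated separately.

  The rest is the passage from the Kronecker product to entries. Put \<open>q = 2\<^sup>n\<^sup>-\<^sup>i\<close> with \<open>n = m - 1\<close>.
  Row \<open>r = q R + s\<close> (\<open>s < q\<close>) of the matrix is zero outside the two columns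
  \<open>q (2 R + \<beta>) + s\<close> for \<open>\<beta> = 0, 1\<close>, where it has \<open>1\<close> and \<open>\<lambda>\<close> (lemma \<open>minor_unscaled_nth\<close>), and these column numbers are the
  binary numbers obtained from \<open>r\<close> by inserting the bit \<open>\<beta>\<close> in position \<open>i\<close>
  (lemma \<open>seq_of_index_insert_bit\<close>).
\<close>

section \<open>The Moebius map of the parameter\<close>

lemma lam_denominator_nonzero:
  assumes "\<mu> \<noteq> complex_of_real (3 + 2 * sqrt 2)"
  shows "of_real (sqrt 2) + 1 - (of_real (sqrt 2) - 1) * \<mu> \<noteq> 0"
proof
  define s where "s = complex_of_real (sqrt 2)"
  have s2: "s * s = 2"
    unfolding s_def by (simp flip: of_real_mult)
  assume "of_real (sqrt 2) + 1 - (of_real (sqrt 2) - 1) * \<mu> = 0"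
  then have "(s - 1) * \<mu> = s + 1"
    by (simp add: s_def)
  \<comment> \<open>\<open>s + 1\<close> is the inverse of \<open>s - 1\<close>, so multiplying by it isolates \<open>\<mu>\<close>.\<close>
  then have "(s + 1) * (s - 1) * \<mu> = (s + 1) * (s + 1)"
    by (simp only: mult.assoc)
  then have "\<mu> = 3 + 2 * s"
    using s2 by (simp add: algebra_simps)
  with assms show False
    by (simp add: s_def)
qed

lemma lam_eq_iff:
  assumes "\<mu> \<noteq> complex_of_real (3 + 2 * sqrt 2)" and "\<nu> \<noteq> complex_of_real (3 + 2 * sqrt 2)"
  shows "lam \<mu> = lam \<nu> \<longleftrightarrow> \<mu> = \<nu>"
proof
  define s where "s = complex_of_real (sqrt 2)"
  have "s \<noteq> 0"
    by (simp add: s_def)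
  assume "lam \<mu> = lam \<nu>"
  then have "(1 + \<mu>) * (s + 1 - (s - 1) * \<nu>) = (1 + \<nu>) * (s + 1 - (s - 1) * \<mu>)"
    using lam_denominator_nonzero[OF assms(1)] lam_denominator_nonzero[OF assms(2)]
    by (simp add: lam_def s_def frac_eq_eq)
  \<comment> \<open>The difference of the two sides is the determinant times \<open>\<mu> - \<nu>\<close>.\<close>
  then have "(2 * s) * (\<mu> - \<nu>) = 0"
    by (simp add: algebra_simps)
  with \<open>s \<noteq> 0\<close> show "\<mu> = \<nu>"
    by simp
qed simp

lemma linear_fractional_eq_iff:
  fixes k l a b d :: "'a :: field"
  assumes "k \<noteq> l" and "1 + k * d \<noteq> 0" and "1 + l * d \<noteq> 0"
  shows "(a + k * b) / (1 + k * d) = (a + l * b) / (1 + l * d) \<longleftrightarrow> b = a * d"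
proof -
  have "(a + k * b) / (1 + k * d) = (a + l * b) / (1 + l * d)
      \<longleftrightarrow> (a + k * b) * (1 + l * d) - (a + l * b) * (1 + k * d) = 0"
    using assms(2,3) by (simp add: frac_eq_eq)
  also have "(a + k * b) * (1 + l * d) - (a + l * b) * (1 + k * d) = (k - l) * (b - a * d)"
    by (simp add: algebra_simps)
  finally show ?thesis
    using assms(1) by simp
qed

section \<open>Bit insertion and binary numbers\<close>

text \<open>
  Write \<open>k\<close> for the index on the left and \<open>q = 2 ^ (n - i)\<close>. Then \<open>k div (2 q) = r div q\<close> gives
  the bits in front of position \<open>i\<close>, \<open>k div q\<close> ends in the inserted bit, and \<open>k\<close> and \<open>r\<close> agree
  modulo \<open>q\<close>, which gives the bits behind it.
\<close>

lemma seq_of_index_insert_bit: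
  assumes "i \<le> n"
  shows "seq_of_index (Suc n) (2 ^ (n - i) * (2 * (r div 2 ^ (n - i)) + of_bool b) + r mod 2 ^ (n - i))
    = insert_bit (seq_of_index n r) i b" (is "seq_of_index _ ?k = _")
proof (rule nth_equalityI)
  define q :: nat where "q = 2 ^ (n - i)"
  define k where "k = q * (2 * (r div q) + of_bool b) + r mod q"
  have "q > 0"
    by (simp add: q_def)
  then have kq: "k div q = 2 * (r div q) + of_bool b"
    by (simp add: k_def)
  show "length (seq_of_index (Suc n) ?k) = length (insert_bit (seq_of_index n r) i b)"
    using assms by (simp add: insert_bit_def)
  fix j assume "j < length (seq_of_index (Suc n) ?k)"
  then have j: "j \<le> n"
    by simp
  then have lhs: "seq_of_index (Suc n) k ! j \<longleftrightarrow> odd (k div 2 ^ (n - j))"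
    by (simp add: seq_of_index_def del: upt_Suc)
  have nth_r: "seq_of_index n r ! l \<longleftrightarrow> odd (r div 2 ^ (n - 1 - l))" if "l < n" for l
    using that by (simp add: seq_of_index_def)
  consider "j < i" | "j = i" | "i < j"
    by linarith
  then have "seq_of_index (Suc n) k ! j = insert_bit (seq_of_index n r) i b ! j"
  proof cases
    case 1
    then have exps: "n - j = (n - i) + Suc (i - 1 - j)" "n - 1 - j = (n - i) + (i - 1 - j)"
      using assms by auto
    have "k div 2 ^ (n - j) = k div q div 2 div 2 ^ (i - 1 - j)"
      unfolding exps(1) power_add power_Suc q_def by (simp only: div_mult2_eq)
    also have "\<dots> = r div q div 2 ^ (i - 1 - j)"
      by (simp add: kq)
    also have "\<dots> = r div 2 ^ (n - 1 - j)"
      unfolding exps(2) power_add q_def by (simp only: div_mult2_eq)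
    finally show ?thesis
      using 1 assms lhs nth_r[of j] by (simp add: insert_bit_def nth_append)
  next
    case 2
    then show ?thesis
      using assms lhs kq by (simp add: insert_bit_def nth_append q_def)
  next
    case 3
    define p :: nat where "p = 2 ^ (n - j)"
    have "n - i = (n - j) + Suc (j - 1 - i)"
      using 3 j by auto
    then have qp: "q = p * (2 * 2 ^ (j - 1 - i))"
      unfolding q_def p_def by (simp only: power_add power_Suc)
    have "p > 0"
      by (simp add: p_def)
    then have parity: "odd ((q * x + t) div p) \<longleftrightarrow> odd (t div p)" for x t
      by (simp add: qp mult.assoc)
    have "odd (k div p) \<longleftrightarrow> odd (r mod q div p)"
      by (simp only: k_def parity)
    also have "\<dots> \<longleftrightarrow> odd (r div p)"
      using parity[of "r div q" "r mod q"] by simp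
    finally show ?thesis
      using 3 j assms lhs nth_r[of "j - 1"] by (auto simp: insert_bit_def nth_append nth_Cons' p_def)
  qed
  then show "seq_of_index (Suc n) ?k ! j = insert_bit (seq_of_index n r) i b ! j"
    by (simp only: k_def q_def)
qed

lemma seq_of_index_0: "seq_of_index n 0 = zero_seq n"
  by (simp add: seq_of_index_def zero_seq_def map_replicate_const)

lemma seq_index_less: "seq_index x < 2 ^ length x"
proof (induction x rule: rev_induct)
  case Nil
  then show ?case by (simp add: seq_index_def)
next
  case (snoc b x)
  then show ?case by (simp add: seq_index_snoc)
qed

text \<open>This allows the entries of a vector of length \<open>2 ^ n\<close> to be indexed by bit sequences.\<close>

lemma all_less_power_iff_all_seq:
  "(\<forall>r < 2 ^ n. P (seq_of_index n r)) \<longleftrightarrow> (\<forall>G. length G = n \<longrightarrow> P G)"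
  by (metis length_seq_of_index seq_index_less seq_of_index_seq_index)

lemma bf_entry_insert_bit_zero:
  assumes "binary_function m es f" and "i < m"
  shows "bf_entry es f (insert_bit (zero_seq (m - 1)) i False) = 1"
proof -
  have "insert_bit (zero_seq (m - 1)) i False = replicate i False @ replicate (Suc (m - 1 - i)) False"
    using assms(2) by (simp add: insert_bit_def zero_seq_def)
  also have "\<dots> = replicate m False"
    unfolding replicate_add[symmetric] using assms(2) by simp
  finally have "subset_of_seq es (insert_bit (zero_seq (m - 1)) i False) = {}"
    using assms(1) by (auto simp: subset_of_seq_def binary_function_def)
  then show ?thesis
    using assms(1) by (simp add: bf_entry_def binary_function_def)
qed

section \<open>Entries of the minors\<close>

lemma kron_one: "kron (1\<^sub>m a) (1\<^sub>m b) = 1\<^sub>m (a * b)"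
proof (rule eq_matI)
  fix r c assume "r < dim_row (1\<^sub>m (a * b) :: complex mat)" "c < dim_col (1\<^sub>m (a * b) :: complex mat)"
  then have rc: "r < a * b" "c < a * b"
    by auto
  then have "b > 0"
    by (cases b) auto
  moreover have "r div b < a" "c div b < a"
    using rc by (simp_all add: less_mult_imp_div_less)
  moreover have "r = c" if "r div b = c div b" "r mod b = c mod b"
    using that by (metis div_mult_mod_eq)
  ultimately show "kron (1\<^sub>m a) (1\<^sub>m b) $$ (r, c) = 1\<^sub>m (a * b) $$ (r, c)"
    using rc by (auto simp: kron_def)
qed (simp_all add: kron_def)

lemma kron_power_one: "kron_power (1\<^sub>m k) n = 1\<^sub>m (k ^ n)"
  by (induction n) (simp_all add: kron_one)

text \<open>
  Sandwiching a row between identities: column \<open>c\<close> of row \<open>r\<close> is nonzero only if the leading and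
  trailing digits of \<open>c\<close>, in the mixed radix system given by the factors, are those of \<open>r\<close>; the
  middle digit of \<open>c\<close> selects the entry of the row.
\<close>

lemma kron_one_row_one_nth:
  assumes "r < p * q" and "c < p * 2 * q"
  shows "kron (kron (1\<^sub>m p) (mat_of_rows_list 2 [[1, l]])) (1\<^sub>m q) $$ (r, c)
    = (if c div q div 2 = r div q \<and> c mod q = r mod q then if even (c div q) then 1 else l else 0)"
proof -
  have "q > 0"
    using assms(1) by (cases q) auto
  moreover have rq: "r div q < p" and cq: "c div q < p * 2"
    using assms by (simp_all add: less_mult_imp_div_less)
  moreover have "c div q div 2 < p"
    using cq by (simp add: less_mult_imp_div_less)
  moreover have "[1, l] ! (c div q mod 2) = (if even (c div q) then 1 else l)"
    by (simp add: mod2_eq_if)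
  ultimately show ?thesis
    using assms by (auto simp: kron_def mat_of_rows_list_def)
qed

lemma dim_minor_unscaled:
  assumes "i \<le> n"
  shows "dim_vec (minor_unscaled (Suc n) \<mu> v i) = 2 ^ n"
  using assms
  by (simp add: minor_unscaled_def kron_power_one kron_def mat_of_rows_list_def flip: power_add)

text \<open>
  Only two columns share the leading and trailing digits of the row, one for each middle digit \<open>b\<close>,
  so the matrix-vector product collapses to two terms. The second conclusion makes it possible to
  read the components at these positions when \<open>v\<close> is given by its entries.
\<close>

lemma minor_unscaled_nth:
  assumes "i \<le> n" and "r < 2 ^ n" and "dim_vec v = 2 ^ Suc n"
  defines "pos \<equiv> \<lambda>b. 2 ^ (n - i) * (2 * (r div 2 ^ (n - i)) + of_bool b) + r mod 2 ^ (n - i)"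
  shows "minor_unscaled (Suc n) \<mu> v i $ r = v $ pos False + lam \<mu> * v $ pos True"
    and "pos b < 2 ^ Suc n"
proof -
  define p q :: nat where "p = 2 ^ i" and "q = 2 ^ (n - i)"
  define M where "M = kron (kron (1\<^sub>m p) (mat_of_rows_list 2 [[1, lam \<mu>]])) (1\<^sub>m q)"
  have q: "q > 0"
    by (simp add: q_def)
  have pq: "p * q = 2 ^ n"
    using assms(1) by (simp add: p_def q_def flip: power_add)
  have pos_def': "pos b = q * (2 * (r div q) + of_bool b) + r mod q" for b
    by (simp add: pos_def q_def)
  have pos_less: "pos b < p * 2 * q" for b
  proof -
    have "r div q < p"
      using assms(2) pq by (simp add: less_mult_imp_div_less)
    then have "2 * (r div q) + of_bool b + 1 \<le> p * 2"
      by (cases b) auto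
    then have "q * (2 * (r div q) + of_bool b + 1) \<le> q * (p * 2)"
      by (rule mult_le_mono2)
    moreover have "r mod q < q"
      using q by simp
    ultimately show ?thesis
      by (simp add: pos_def' algebra_simps)
  qed
  have pq2: "p * 2 * q = 2 ^ Suc n"
    by (simp add: mult_ac flip: pq)
  show "pos b < 2 ^ Suc n"
    using pos_less unfolding pq2 .
  have dim_M: "dim_row M = 2 ^ n" "dim_col M = 2 ^ Suc n"
    unfolding pq[symmetric] pq2[symmetric] by (simp_all add: M_def kron_def mat_of_rows_list_def)
  have entry: "M $$ (r, c) = (if c = pos False then 1 else 0) + (if c = pos True then lam \<mu> else 0)"
    if "c < p * 2 * q" for c
  proof -
    have digits: "c = pos b \<longleftrightarrow> c div q = 2 * (r div q) + of_bool b \<and> c mod q = r mod q" for b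
    proof
      assume "c = pos b"
      then show "c div q = 2 * (r div q) + of_bool b \<and> c mod q = r mod q"
        using q by (simp add: pos_def')
    next
      assume "c div q = 2 * (r div q) + of_bool b \<and> c mod q = r mod q"
      then show "c = pos b"
        using mult_div_mod_eq[of q c] by (simp add: pos_def')
    qed
    have "x div 2 = y \<longleftrightarrow> x = 2 * y \<or> x = 2 * y + 1" for x y :: nat
      by presburger
    then show ?thesis
      using that assms(2) pq by (auto simp: M_def kron_one_row_one_nth digits)
  qed
  have "minor_unscaled (Suc n) \<mu> v i $ r = (M *\<^sub>v v) $ r"
    by (simp add: minor_unscaled_def kron_power_one M_def p_def q_def)
  also have "\<dots> = (\<Sum>c < p * 2 * q. M $$ (r, c) * v $ c)"
    unfolding pq2
    using assms(2,3) dim_M by (simp add: scalar_prod_def lessThan_atLeast0 mult.commute)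
  also have "\<dots> = (\<Sum>c < p * 2 * q. (if c = pos False then v $ c else 0)
      + (if c = pos True then lam \<mu> * v $ c else 0))"
    by (intro sum.cong) (auto simp: entry distrib_right)
  also have "\<dots> = v $ pos False + lam \<mu> * v $ pos True"
    using pos_less by (simp add: sum.distrib)
  finally show "minor_unscaled (Suc n) \<mu> v i $ r = v $ pos False + lam \<mu> * v $ pos True" .
qed

lemma minor_unscaled_bf_vec_nth:
  assumes "i \<le> n" and "r < 2 ^ n" and "length es = Suc n"
  shows "minor_unscaled (Suc n) \<mu> (bf_vec es f) i $ r
    = bf_entry es f (insert_bit (seq_of_index n r) i False)
      + lam \<mu> * bf_entry es f (insert_bit (seq_of_index n r) i True)"
proof -
  have dim: "dim_vec (bf_vec es f) = 2 ^ Suc n"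
    using assms(3) by (simp add: bf_vec_def)
  have nth: "bf_vec es f $ k = bf_entry es f (seq_of_index (Suc n) k)" if "k < 2 ^ Suc n" for k
    using that assms(3) by (simp add: bf_vec_def)
  show ?thesis
    unfolding minor_unscaled_nth(1)[OF assms(1,2) dim] nth[OF minor_unscaled_nth(2)[OF assms(1,2) dim]]
      seq_of_index_insert_bit[OF assms(1)] ..
qed

lemma minor_defined_iff:
  assumes "dim_vec (minor_unscaled m \<mu> v i) > 0"
  shows "minor_defined m \<mu> v i \<longleftrightarrow> minor_unscaled m \<mu> v i $ 0 \<noteq> 0"
  using assms by (auto simp: minor_defined_def intro!: exI[of _ "1 / minor_unscaled m \<mu> v i $ 0"])

lemma mu_minor_eq:
  assumes "dim_vec (minor_unscaled m \<mu> v i) > 0" and "minor_unscaled m \<mu> v i $ 0 \<noteq> 0"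
  shows "mu_minor m \<mu> v i = (1 / minor_unscaled m \<mu> v i $ 0) \<cdot>\<^sub>v minor_unscaled m \<mu> v i"
proof -
  have "(THE c. (c \<cdot>\<^sub>v minor_unscaled m \<mu> v i) $ 0 = 1) = 1 / minor_unscaled m \<mu> v i $ 0"
    using assms by (intro the_equality) (auto simp: field_simps)
  then show ?thesis
    by (simp add: mu_minor_def)
qed

section \<open>Degenerate elements\<close>

theorem corollary4:
  fixes \<mu>1 \<mu>2 :: complex and m i :: nat and es :: "'a list" and f :: "'a set \<Rightarrow> complex"
  assumes "\<mu>1 \<noteq> complex_of_real (3 + 2 * sqrt 2)" and "\<mu>2 \<noteq> complex_of_real (3 + 2 * sqrt 2)"
    and "\<mu>1 \<noteq> \<mu>2"
    and "m \<ge> 1" and "binary_function m es f" and "i < m"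
    and "minor_defined m \<mu>1 (bf_vec es f) i" and "minor_defined m \<mu>2 (bf_vec es f) i"
  shows "(degenerate {mu_minor m \<mu>1, mu_minor m \<mu>2} (bf_vec es f) i \<longleftrightarrow>
           (\<forall>G. length G = m - 1 \<longrightarrow>
             bf_entry es f (insert_bit G i True) * bf_entry es f (insert_bit (zero_seq (m - 1)) i False)
             = bf_entry es f (insert_bit G i False) * bf_entry es f (insert_bit (zero_seq (m - 1)) i True)))
       \<and> ((\<forall>G. length G = m - 1 \<longrightarrow>
             bf_entry es f (insert_bit G i True) * bf_entry es f (insert_bit (zero_seq (m - 1)) i False)
             = bf_entry es f (insert_bit G i False) * bf_entry es f (insert_bit (zero_seq (m - 1)) i True))
           \<longleftrightarrow>
           (\<forall>G. length G = m - 1 \<longrightarrow>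
             (bf_entry es f (insert_bit G i False) \<noteq> 0 \<and>
              bf_entry es f (insert_bit G i True) / bf_entry es f (insert_bit G i False)
              = bf_entry es f (insert_bit (zero_seq (m - 1)) i True)
                / bf_entry es f (insert_bit (zero_seq (m - 1)) i False))
             \<or> (bf_entry es f (insert_bit G i False) = 0 \<and> bf_entry es f (insert_bit G i True) = 0)))"
proof -
  obtain n where n: "m = Suc n"
    using assms(4) by (cases m) auto
  then have i: "i \<le> n" and len: "length es = Suc n"
    using assms(5,6) by (auto simp: binary_function_def)
  define a where "a G = bf_entry es f (insert_bit G i False)" for G
  define b where "b G = bf_entry es f (insert_bit G i True)" for G
  define u where "u \<mu> = minor_unscaled m \<mu> (bf_vec es f) i" for \<mu>
  have a0: "a (zero_seq n) = 1"
    using bf_entry_insert_bit_zero[OF assms(5,6)] by (simp add: a_def n)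
  have dim_u: "dim_vec (u \<mu>) = 2 ^ n" for \<mu>
    using dim_minor_unscaled[OF i] by (simp add: u_def n)
  have u_nth: "u \<mu> $ r = a (seq_of_index n r) + lam \<mu> * b (seq_of_index n r)" if "r < 2 ^ n" for \<mu> r
    using minor_unscaled_bf_vec_nth[OF i that len] by (simp add: u_def n a_def b_def)
  have u0: "u \<mu> $ 0 = 1 + lam \<mu> * b (zero_seq n)" for \<mu>
    using u_nth[of 0 \<mu>] by (simp add: seq_of_index_0 a0)
  have u0_nonzero: "1 + lam \<mu>1 * b (zero_seq n) \<noteq> 0" "1 + lam \<mu>2 * b (zero_seq n) \<noteq> 0"
    using assms(7,8) dim_u by (simp_all add: minor_defined_iff flip: u_def u0)
  have minor_eq: "mu_minor m \<mu> (bf_vec es f) i = (1 / u \<mu> $ 0) \<cdot>\<^sub>v u \<mu>" if "u \<mu> $ 0 \<noteq> 0" for \<mu>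
    unfolding u_def by (rule mu_minor_eq) (use dim_u that in \<open>simp_all flip: u_def\<close>)
  have lam_neq: "lam \<mu>1 \<noteq> lam \<mu>2"
    using assms(3) by (simp add: lam_eq_iff[OF assms(1,2)])
  have "degenerate {mu_minor m \<mu>1, mu_minor m \<mu>2} (bf_vec es f) i
      \<longleftrightarrow> (1 / u \<mu>1 $ 0) \<cdot>\<^sub>v u \<mu>1 = (1 / u \<mu>2 $ 0) \<cdot>\<^sub>v u \<mu>2"
    using u0_nonzero by (auto simp: degenerate_def minor_eq u0)
  also have "\<dots> \<longleftrightarrow> (\<forall>r < 2 ^ n. u \<mu>1 $ r / u \<mu>1 $ 0 = u \<mu>2 $ r / u \<mu>2 $ 0)"
    by (simp add: vec_eq_iff dim_u)
  also have "\<dots> \<longleftrightarrow> (\<forall>r < 2 ^ n. b (seq_of_index n r) = a (seq_of_index n r) * b (zero_seq n))"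
    unfolding u0 using linear_fractional_eq_iff[OF lam_neq u0_nonzero] by (simp add: u_nth)
  also have "\<dots> \<longleftrightarrow> (\<forall>G. length G = n \<longrightarrow> b G = a G * b (zero_seq n))"
    by (rule all_less_power_iff_all_seq)
  finally have a_iff_b: "degenerate {mu_minor m \<mu>1, mu_minor m \<mu>2} (bf_vec es f) i
      \<longleftrightarrow> (\<forall>G. length G = n \<longrightarrow> b G = a G * b (zero_seq n))" .
  have b_iff_c: "b G = a G * b (zero_seq n)
      \<longleftrightarrow> (a G \<noteq> 0 \<and> b G / a G = b (zero_seq n)) \<or> (a G = 0 \<and> b G = 0)" for G
    by (auto simp: field_simps)
  have m1: "m - 1 = n"
    by (simp add: n)
  show ?thesis
    unfolding m1 a_def[symmetric] b_def[symmetric] a0 mult_1_right div_by_1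
    using a_iff_b b_iff_c by simp
qed

end
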